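(* Let $S_n=(S_n^x,S_n^y)$, $n\ge 0$, be the simple random walk on the 2-dimensional comb $\mathbf C_2$ started at $S_0=(0,0)$, and let $M_n^y=\max\{S_i^y-S_j^y:0\le i,j\le n\}$. Then $$\mathbb E[M_n^y]\sim\sqrt{\frac{8}{\pi}}\,n^{1/2}\qquad (n\to\infty).$$
   Context: The 2-dimensional comb $\mathbf C_2$ is the graph with vertex set $\mathbb Z^2$ obtained from the usual square lattice by removing all horizontal edges off the $x$-axis: $(x,y)$ is adjacent to $(x,y\pm1)$ for all $x,y\in\mathbb Z$, and $(x,0)$ is adjacent to $(x\pm1,0)$ for all $x\in\mathbb Z$. The simple random walk moves at each step to a uniformly chosen neighbour of the current vertex (transition probabilities $1/4$ from vertices on the $x$-axis and $1/2$ from other vertices). $a_n\sim b_n$ means $a_n/b_n\to1$. *)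

theory Defs
  imports "HOL-Probability.Probability" "HOL-Library.Landau_Symbols"
begin

definition comb_adj :: "int \<times> int \<Rightarrow> int \<times> int \<Rightarrow> bool" where
  "comb_adj v w \<longleftrightarrow>
     fst v = fst w \<and> \<bar>snd v - snd w\<bar> = 1 \<or>
     snd v = 0 \<and> snd w = 0 \<and> \<bar>fst v - fst w\<bar> = 1"

text \<open>
  Intended for graphs in which every vertex has finitely many and at least one neighbour;
  otherwise \<open>pmf_of_set\<close> is unspecified. The comb satisfies this, see below.
\<close>
locale simple_random_walk = prob_space M
  for M :: "'w measure" +
  fixes adj :: "'v \<Rightarrow> 'v \<Rightarrow> bool"
    and start :: 'v
    and S :: "nat \<Rightarrow> 'w \<Rightarrow> 'v"
  assumes measurable_S: "\<And>n. random_variable (count_space UNIV) (S n)"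
    and S_start: "AE \<omega> in M. S 0 \<omega> = start"
    and S_step: "\<And>n s. \<P>(\<omega> in M. \<forall>i\<le>n. S i \<omega> = s i) > 0 \<Longrightarrow>
      \<P>(\<omega> in M. S (Suc n) \<omega> = s (Suc n) \<bar> \<forall>i\<le>n. S i \<omega> = s i)
        = pmf (pmf_of_set {w. adj (s n) w}) (s (Suc n))"

definition span_y :: "(nat \<Rightarrow> 'w \<Rightarrow> int \<times> int) \<Rightarrow> nat \<Rightarrow> 'w \<Rightarrow> int" where
  "span_y S n \<omega> = Max {snd (S i \<omega>) - snd (S j \<omega>) |i j. i \<le> n \<and> j \<le> n}"

lemma comb_neighbours:
  "{w. comb_adj (x, y) w} =
     (if y = 0 then {(x, 1), (x, -1), (x + 1, 0), (x - 1, 0)} else {(x, y + 1), (x, y - 1)})"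
  by (auto simp: comb_adj_def)

lemma comb_transition:
  "pmf (pmf_of_set {w. comb_adj (x, y) w}) w =
     (if comb_adj (x, y) w then (if y = 0 then 1 / 4 else 1 / 2) else 0)"
proof -
  let ?N = "{w. comb_adj (x, y) w}"
  have "finite ?N" "?N \<noteq> {}" "card ?N = (if y = 0 then 4 else 2)"
    unfolding comb_neighbours by auto
  then show ?thesis
    by (simp add: pmf_of_set indicator_def)
qed

end

theory Submission
  imports Defs
begin

text \<open>
  The span is the maximum of the vertical coordinate plus that of its negative, so it suffices to show that
  each of the two maxima has expectation asymptotic to \<open>sqrt (2 * n / pi)\<close>. The vertical coordinate is a simple
  random walk that is held back, with probability \<open>1/2\<close> per step, while it is at \<open>0\<close>. It is at
  \<open>0\<close> only of order \<open>sqrt n\<close> times up to time \<open>n\<close>, so the holding should not change the leading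
  order; the proof makes this precise without any coupling.

  Let \<open>mean_gap k d\<close> be the expected height to which a simple random walk has raised its running maximum
  after \<open>k\<close> steps, measured from its present position \<open>d\<close> below that maximum. It has an explicit form:
  \<open>mean_gap (Suc k) d - mean_gap k d\<close> is half of the binomial probability \<open>record_prob k d\<close>, and at \<open>d = 0\<close> the
  sum telescopes (\<open>mean_gap_closed\<close>), which gives \<open>mean_gap n 0 / sqrt n \<longlonglongrightarrow> sqrt (2 / pi)\<close> (\<open>mean_gap_limit\<close>).

  Along the comb walk consider the present height plus \<open>mean_gap k\<close> of the present gap, where \<open>k\<close> is the
  time that remains. Off the axis it is a martingale. On the axis it loses \<open>record_prob k d / 4\<close> in the
  mean (\<open>step_mean_predicted_peak\<close>), because half of the steps there are horizontal. At
  the end it equals the maximum. Therefore the expected maximum is \<open>mean_gap n 0\<close> minus a sum over the times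
  \<open>i < n\<close> of terms between \<open>0\<close> and \<open>P(on the axis at time i) * record_prob (n - 1 - i) 0\<close>
  (\<open>comb_mean_peak\<close>). The first factors add up to at most \<open>2 * sqrt n\<close> by a discrete Tanaka formula
  (\<open>axis_visits_bound\<close>), and \<open>record_prob k 0\<close> tends to \<open>0\<close>. So the loss is \<open>o(sqrt n)\<close>
  (\<open>convolution_negligible\<close>).
\<close>

section \<open>The expected gap of simple random walk\<close>

text \<open>
  For simple random walk on \<open>\<int>\<close>, call the distance from the current position up to the running maximum
  the gap. From gap \<open>d\<close> it moves to \<open>d + 1\<close> or to \<open>d - 1\<close>, except that at gap \<open>0\<close> an upward step raises
  the maximum and leaves the gap at \<open>0\<close>; truncated subtraction on \<open>nat\<close> encodes exactly this rule.
  This is the walk \<open>\<bar>X + 1/2\<bar> - 1/2\<close>, where \<open>X\<close> is a simple random walk started at \<open>d\<close>. So the gap is \<open>0\<close>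
  at time \<open>k\<close> iff \<open>X\<close> is at \<open>0\<close> or at \<open>-1\<close>; parity admits only one of the two, and the binomial
  coefficient below counts the ways to get there.
\<close>

definition record_prob :: "nat \<Rightarrow> nat \<Rightarrow> real" where
  "record_prob k d = real (k choose ((k + d + 1) div 2)) / 2 ^ k"

text \<open>
  The expected gap after \<open>k\<close> steps from gap \<open>d\<close>. The gap has no drift except at \<open>0\<close>, where it grows
  by \<open>1/2\<close> on average. As the walk itself is a martingale, this is also the expected
  height of the maximum after \<open>k\<close> steps above the position at the start.
\<close>

definition mean_gap :: "nat \<Rightarrow> nat \<Rightarrow> real" where
  "mean_gap k d = real d + (\<Sum>i<k. record_prob i d) / 2"

lemma binomial_middle_symmetric: "k choose (k div 2) = k choose ((k + 1) div 2)"
  by (subst binomial_symmetric) (auto intro!: arg_cong[where f = "(choose) k"])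

text \<open>
  Pascal's rule, except at \<open>d = 0\<close>, where \<open>d - 1\<close> is again \<open>0\<close> and the symmetry of the
  middle binomial coefficients takes over.
\<close>

lemma record_prob_Suc: "record_prob (Suc k) d = (record_prob k (d - 1) + record_prob k (d + 1)) / 2"
proof (cases d)
  case 0
  have "k choose (k div 2) = k choose ((k + 1) div 2)"
    by (rule binomial_middle_symmetric)
  then show ?thesis
    using 0 by (simp add: record_prob_def field_simps)
next
  case (Suc e)
  have "Suc k + d + 1 = k + e + 1 + 2" "k + (d + 1) + 1 = k + e + 1 + 2"
    using Suc by auto
  then show ?thesis
    using Suc by (simp add: record_prob_def field_simps)
qed

lemma mean_gap_Suc: "mean_gap (Suc k) d = mean_gap k d + record_prob k d / 2"
  by (simp add: mean_gap_def add_divide_distrib)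

text \<open>
  The backward equation of the gap process, inherited from \<open>record_prob\<close> because \<open>mean_gap\<close>
  accumulates it. At the start the truncated average of \<open>d\<close> exceeds \<open>d\<close> only at \<open>d = 0\<close>, by
  \<open>1/2 = record_prob 0 0 / 2\<close>.
\<close>

lemma mean_gap_step: "mean_gap (Suc k) d = (mean_gap k (d - 1) + mean_gap k (d + 1)) / 2"
proof (induction k)
  case 0
  show ?case by (cases d) (auto simp: mean_gap_def record_prob_def)
next
  case (Suc k)
  have "mean_gap (Suc (Suc k)) d =
      (mean_gap k (d - 1) + mean_gap k (d + 1)) / 2
      + (record_prob k (d - 1) + record_prob k (d + 1)) / 2 / 2"
    unfolding mean_gap_Suc[of "Suc k"] Suc record_prob_Suc ..
  then show ?case
    unfolding mean_gap_Suc[of k "d - 1"] mean_gap_Suc[of k "d + 1"] by (simp add: field_simps)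
qed

lemma record_prob_nonneg: "record_prob k d \<ge> 0"
  by (simp add: record_prob_def)

lemma record_prob_le_gap_0: "record_prob k d \<le> record_prob k 0"
proof -
  have "k choose (k div 2) = k choose ((k + 1) div 2)"
    by (rule binomial_middle_symmetric)
  then have "k choose ((k + d + 1) div 2) \<le> k choose ((k + 0 + 1) div 2)"
    using binomial_maximum[of k "(k + d + 1) div 2"] by simp
  then show ?thesis
    unfolding record_prob_def by (intro divide_right_mono) auto
qed

lemma record_prob_le_1: "record_prob k d \<le> 1"
proof -
  have "real (k choose ((k + d + 1) div 2)) \<le> real (2 ^ k)"
    unfolding of_nat_le_iff by (rule binomial_le_pow2)
  then show ?thesis by (simp add: record_prob_def)
qed

lemma record_prob_even:
  assumes "even n" shows "record_prob (Suc n) 0 = (n + 1) / (n + 2) * record_prob n 0"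
proof -
  obtain k where n: "n = 2 * k" using assms by auto
  have "Suc k * (Suc (2 * k) choose Suc k) = Suc (2 * k) * (2 * k choose k)"
    by (rule Suc_times_binomial)
  then have "real (k + 1) * real (Suc (2 * k) choose Suc k) = real (2 * k + 1) * real (2 * k choose k)"
    unfolding of_nat_mult[symmetric] by (simp del: binomial_Suc_Suc)
  then have "real (Suc (2 * k) choose Suc k) = real (2 * k + 1) * real (2 * k choose k) / real (k + 1)"
    by (simp add: field_simps)
  moreover have "record_prob (Suc n) 0 = real (Suc (2 * k) choose Suc k) / (2 * 2 ^ (2 * k))"
    "record_prob n 0 = real (2 * k choose k) / 2 ^ (2 * k)"
    by (simp_all add: n record_prob_def del: binomial_Suc_Suc)
  moreover have "real (2 * k + 1) * c / real (k + 1) / (2 * p) = (n + 1) / (n + 2) * (c / p)"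
    if "p > 0" for c p :: real
    using that unfolding n by (simp add: divide_simps)
  ultimately show ?thesis by (simp add: add.commute)
qed

lemma record_prob_odd:
  assumes "odd n" shows "record_prob (Suc n) 0 = record_prob n 0"
proof -
  obtain k where n: "n = 2 * k + 1" using assms oddE by blast
  have "Suc (2 * k) choose k = Suc (2 * k) choose Suc k"
    by (subst binomial_symmetric) (auto intro!: arg_cong[where f = "(choose) (Suc (2 * k))"])
  then have "Suc n choose Suc k = 2 * (n choose Suc k)"
    by (simp add: n binomial_Suc_Suc[of "Suc (2 * k)"] del: binomial_Suc_Suc)
  then show ?thesis by (simp add: n record_prob_def field_simps del: binomial_Suc_Suc)
qed

text \<open>
  The sum of middle binomial probabilities telescopes, so that no summation asymptotics are needed:
  its growth can be read off from that of the last summand.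
\<close>

lemma mean_gap_closed:
  "mean_gap n 0 = (if even n then (2 * n + 1) * record_prob n 0 - 1
     else (2 * n + 2) * record_prob n 0 - 1) / 2"
proof (induction n)
  case 0
  show ?case by (simp add: mean_gap_def record_prob_def)
next
  case (Suc n)
  show ?case
  proof (cases "even n")
    case True
    then have "record_prob n 0 = 2 * mean_gap n 0 + 1 - 2 * n * record_prob n 0"
      using Suc by (simp add: field_simps)
    moreover have "(n + 2) * record_prob (Suc n) 0 = (n + 1) * record_prob n 0"
      using True by (simp add: record_prob_even field_simps)
    ultimately show ?thesis
      using True by (simp add: mean_gap_Suc algebra_simps)
  next
    case False
    then show ?thesis
      using Suc by (simp add: mean_gap_Suc record_prob_odd field_simps)
  qed
qed

text \<open>
  The central binomial probabilities are the Taylor coefficients of \<open>(1 - x) powr (-1/2)\<close>. In this form their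
  asymptotics follow from those of generalised binomial coefficients, and \<open>Gamma (1/2) = sqrt pi\<close> brings
  in the constant.
\<close>

lemma record_prob_gbinomial: "record_prob (2 * k) 0 = (-1) ^ k * (-1/2 gchoose k)"
proof (induction k)
  case 0
  show ?case by (simp add: record_prob_def)
next
  case (Suc k)
  have "record_prob (2 * Suc k) 0 = (2 * k + 1) / (2 * k + 2) * record_prob (2 * k) 0"
    using record_prob_even[of "2 * k"] record_prob_odd[of "Suc (2 * k)"] by (simp add: add.commute)
  moreover have "real (Suc k) * (-1/2 gchoose Suc k) = (-1/2 - k) * (-1/2 gchoose k)"
    using gbinomial_mult_1[of "-1/2 :: real" k] by (simp add: algebra_simps)
  then have "(-1/2 gchoose Suc k) = (-1/2 - real k) / real (Suc k) * (-1/2 gchoose k)"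
    by (simp add: field_simps)
  moreover have "real (2 * k + 1) / real (2 * k + 2) = - ((-1/2 - real k) / real (Suc k))"
    by (simp add: field_simps)
  ultimately show ?case
    by (simp only: Suc.IH power_Suc mult_minus_left mult_minus_right mult_1 mult.assoc mult.left_commute)
qed

lemma record_prob_even_limit:
  "(\<lambda>k. record_prob (2 * k) 0 * sqrt k) \<longlonglongrightarrow> 1 / sqrt pi"
proof -
  have "(\<lambda>n. (-1/2 gchoose n) / ((-1)^n / exp ((-1/2+1) * of_real (ln (real n)))))
      \<longlonglongrightarrow> inverse (Gamma (- (-1/2 :: real)))"
    by (rule gbinomial_asymptotic)
  moreover have "inverse (Gamma (- (-1/2 :: real))) = 1 / sqrt pi"
    by (simp add: Gamma_one_half_real field_simps)
  moreover have "\<forall>\<^sub>F n in sequentially.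
      (-1/2 gchoose n) / ((-1)^n / exp ((-1/2+1) * of_real (ln (real n))))
      = record_prob (2 * n) 0 * sqrt n"
    using eventually_gt_at_top[of 0]
  proof eventually_elim
    case (elim n)
    have "exp ((-1/2+1) * of_real (ln (real n))) = sqrt n"
      using elim by (simp add: powr_half_sqrt[symmetric] powr_def)
    then show ?case
      unfolding record_prob_gbinomial by (cases "even n") auto
  qed
  ultimately show ?thesis
    by (simp add: tendsto_cong)
qed

text \<open>
  An odd time has the same middle probability as the even time that follows it. Hence time \<open>n\<close>
  may be replaced by \<open>2 * ((n + 1) div 2)\<close>.
\<close>

lemma record_prob_limit: "(\<lambda>n. record_prob n 0 * sqrt n) \<longlonglongrightarrow> sqrt (2 / pi)"
proof -
  define m :: "nat \<Rightarrow> nat" where "m n = (n + 1) div 2" for n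
  have eq: "record_prob n 0 = record_prob (2 * m n) 0" for n
    using record_prob_odd[of n] by (cases "even n") (auto simp: m_def elim!: evenE oddE)
  have m_lim: "filterlim m at_top sequentially"
    unfolding filterlim_at_top
  proof
    fix Z show "\<forall>\<^sub>F n in sequentially. Z \<le> m n"
      using eventually_ge_at_top[of "2 * Z"] by eventually_elim (auto simp: m_def)
  qed
  have bounds: "\<forall>\<^sub>F n in sequentially. 2 - 2 / real n \<le> n / m n \<and> n / m n \<le> (2 :: real)"
    using eventually_gt_at_top[of 0]
  proof eventually_elim
    case (elim n)
    have m: "2 * real (m n) \<le> n + 1" "real n \<le> 2 * m n" "real (m n) > 0"
      using elim by (auto simp: m_def)
    have "(2 - 2 / n) * m n \<le> (2 - 2 / n) * ((n + 1) / 2)"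
      using m elim by (intro mult_left_mono) (auto simp: field_simps)
    also have "\<dots> \<le> n" using elim by (simp add: field_simps)
    finally show ?case using m by (simp add: field_simps)
  qed
  have "(\<lambda>n. real n / m n) \<longlonglongrightarrow> 2"
  proof (rule tendsto_sandwich)
    show "(\<lambda>n. 2 - 2 / real n) \<longlonglongrightarrow> 2"
      by (rule LIMSEQ_I) (use LIMSEQ_D[OF lim_const_over_n[of "2::real"]] in auto)
  qed (use bounds in \<open>auto elim: eventually_mono\<close>)
  then have "(\<lambda>n. record_prob (2 * m n) 0 * sqrt (m n) * sqrt (real n / m n)) \<longlonglongrightarrow> 1 / sqrt pi * sqrt 2"
    by (intro tendsto_mult filterlim_compose[OF record_prob_even_limit m_lim] tendsto_real_sqrt)
  moreover have "record_prob (2 * m n) 0 * sqrt (m n) * sqrt (real n / m n) = record_prob n 0 * sqrt n" for n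
    by (cases "n = 0") (auto simp: eq[of n] real_sqrt_divide m_def)
  ultimately show ?thesis
    by (simp add: real_sqrt_divide)
qed

lemma record_prob_tendsto_0: "(\<lambda>n. record_prob n 0) \<longlonglongrightarrow> 0"
proof -
  have "(\<lambda>n. record_prob n 0 * sqrt n * inverse (sqrt n)) \<longlonglongrightarrow> sqrt (2 / pi) * 0"
    by (intro tendsto_mult record_prob_limit tendsto_inverse_0_at_top
        filterlim_compose[OF sqrt_at_top] filterlim_real_sequentially)
  moreover have "\<forall>\<^sub>F n in sequentially. record_prob n 0 * sqrt n * inverse (sqrt n) = record_prob n 0"
    using eventually_gt_at_top[of 0] by eventually_elim simp
  ultimately show ?thesis
    using Lim_transform_eventually by fastforce
qed

lemma mean_gap_limit: "(\<lambda>n. mean_gap n 0 / sqrt n) \<longlonglongrightarrow> sqrt (2 / pi)"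
proof -
  have bounds: "\<forall>\<^sub>F n in sequentially.
      record_prob n 0 * sqrt n - 1 / sqrt n \<le> mean_gap n 0 / sqrt n \<and>
      mean_gap n 0 / sqrt n \<le> record_prob n 0 * sqrt n + 1 / sqrt n"
    using eventually_gt_at_top[of 0]
  proof eventually_elim
    case (elim n)
    have "n * record_prob n 0 - 1 \<le> mean_gap n 0" "mean_gap n 0 \<le> n * record_prob n 0 + 1"
      using record_prob_nonneg[of n 0] record_prob_le_1[of n 0]
      unfolding mean_gap_closed by (auto simp: algebra_simps)
    then have "(n * record_prob n 0 - 1) / sqrt n \<le> mean_gap n 0 / sqrt n"
      "mean_gap n 0 / sqrt n \<le> (n * record_prob n 0 + 1) / sqrt n"
      using elim by (auto intro!: divide_right_mono)
    moreover have "n * record_prob n 0 / sqrt n = record_prob n 0 * sqrt n"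
      using elim by (simp add: field_simps)
    ultimately show ?case by (simp add: add_divide_distrib diff_divide_distrib)
  qed
  have lim: "(\<lambda>n. 1 / sqrt (real n)) \<longlonglongrightarrow> 0"
    unfolding divide_inverse mult_1
    by (intro tendsto_inverse_0_at_top filterlim_compose[OF sqrt_at_top] filterlim_real_sequentially)
  show ?thesis
  proof (rule tendsto_sandwich)
    show "(\<lambda>n. record_prob n 0 * sqrt n - 1 / sqrt n) \<longlonglongrightarrow> sqrt (2 / pi)"
      using tendsto_diff[OF record_prob_limit lim] by simp
    show "(\<lambda>n. record_prob n 0 * sqrt n + 1 / sqrt n) \<longlonglongrightarrow> sqrt (2 / pi)"
      using tendsto_add[OF record_prob_limit lim] by simp
  qed (use bounds in \<open>auto elim: eventually_mono\<close>)
qed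

section \<open>The law of the path\<close>

text \<open>
  Paths are recorded with the latest position first, so that one step of the walk is a single \<open>Cons\<close>
  and the current position is the head.
\<close>

primrec rev_path :: "(nat \<Rightarrow> 'v) \<Rightarrow> nat \<Rightarrow> 'v list" where
  "rev_path s 0 = [s 0]"
| "rev_path s (Suc n) = s (Suc n) # rev_path s n"

primrec path_pmf :: "('v \<Rightarrow> 'v \<Rightarrow> bool) \<Rightarrow> 'v \<Rightarrow> nat \<Rightarrow> 'v list pmf" where
  "path_pmf adj v 0 = return_pmf [v]"
| "path_pmf adj v (Suc n) =
     path_pmf adj v n \<bind> (\<lambda>l. map_pmf (\<lambda>w. w # l) (pmf_of_set {w. adj (hd l) w}))"

lemma set_rev_path: "set (rev_path s n) = s ` {..n}"
  by (induction n) (auto simp: atMost_Suc)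

lemma hd_rev_path: "hd (rev_path s n) = s n"
  by (cases n) auto

lemma rev_path_eq_iff: "rev_path s n = rev_path t n \<longleftrightarrow> (\<forall>i\<le>n. s i = t i)"
  by (induction n) (auto simp: le_Suc_eq)

lemma pmf_Cons_path_pmf:
  "pmf (path_pmf adj v (Suc n)) (w # l) = pmf (path_pmf adj v n) l * pmf (pmf_of_set {w. adj (hd l) w}) w"
proof -
  have "pmf (map_pmf (\<lambda>w. w # l') (pmf_of_set {w. adj (hd l') w})) (w # l)
      = pmf (pmf_of_set {w. adj (hd l) w}) w * indicator {l} l'" for l'
  proof (cases "l' = l")
    case True
    then show ?thesis
      using pmf_map_inj'[of "\<lambda>w. w # l" "pmf_of_set {w. adj (hd l) w}" w] by (auto simp: inj_def)
  next
    case False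
    then show ?thesis by (auto simp: pmf_eq_0_set_pmf)
  qed
  then show ?thesis
    by (simp add: pmf_bind measure_pmf_single)
qed

lemma (in simple_random_walk) measurable_cylinder:
  "{\<omega> \<in> space M. rev_path (\<lambda>i. S i \<omega>) n = l} \<in> sets M"
proof (induction n arbitrary: l)
  case 0
  have "{\<omega> \<in> space M. S 0 \<omega> = hd l} \<in> sets M"
    using measurable_S[of 0] by measurable
  then have "{\<omega> \<in> space M. S 0 \<omega> = hd l \<and> l = [hd l]} \<in> sets M"
    by (cases "l = [hd l]") auto
  also have "{\<omega> \<in> space M. S 0 \<omega> = hd l \<and> l = [hd l]} = {\<omega> \<in> space M. rev_path (\<lambda>i. S i \<omega>) 0 = l}"
    by auto
  finally show ?case .
next
  case (Suc n)
  show ?case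
  proof (cases l)
    case (Cons w l')
    have "{\<omega> \<in> space M. S (Suc n) \<omega> = w} \<in> sets M"
      using measurable_S[of "Suc n"] by measurable
    then have "{\<omega> \<in> space M. S (Suc n) \<omega> = w} \<inter> {\<omega> \<in> space M. rev_path (\<lambda>i. S i \<omega>) n = l'} \<in> sets M"
      using Suc by auto
    then show ?thesis
      using Cons by (simp add: Int_def conj_ac cong: conj_cong)
  qed auto
qed

text \<open>
  The transition probabilities are known only given pasts of positive probability. The induction
  survives the others, since both sides vanish on every extension of a null path.
\<close>

lemma (in simple_random_walk) prob_rev_path:
  "\<P>(\<omega> in M. rev_path (\<lambda>i. S i \<omega>) n = l) = pmf (path_pmf adj start n) l"
proof (induction n arbitrary: l)
  case 0
  have "\<P>(\<omega> in M. rev_path (\<lambda>i. S i \<omega>) 0 = l) = \<P>(\<omega> in M. [start] = l)"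
    using S_start measurable_cylinder[of 0 l]
    by (intro finite_measure_eq_AE) auto
  also have "\<dots> = pmf (return_pmf [start]) l"
    by (auto simp: prob_space indicator_def)
  finally show ?case by simp
next
  case (Suc n)
  show ?case
  proof (cases l)
    case Nil
    then show ?thesis by (auto simp: pmf_eq_0_set_pmf eq_commute[of "[]"] )
  next
    case (Cons w l')
    have IH: "\<P>(\<omega> in M. rev_path (\<lambda>i. S i \<omega>) n = l') = pmf (path_pmf adj start n) l'"
      by (rule Suc)
    show ?thesis
    proof (cases "\<P>(\<omega> in M. rev_path (\<lambda>i. S i \<omega>) n = l') = 0")
      case True
      have "\<P>(\<omega> in M. rev_path (\<lambda>i. S i \<omega>) (Suc n) = l)
          \<le> \<P>(\<omega> in M. rev_path (\<lambda>i. S i \<omega>) n = l')"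
        using Cons by (intro finite_measure_mono measurable_cylinder) auto
      then have "\<P>(\<omega> in M. rev_path (\<lambda>i. S i \<omega>) (Suc n) = l) = 0"
        using True by (simp add: measure_le_0_iff)
      then show ?thesis
        using True IH Cons pmf_Cons_path_pmf[of adj start n w l'] by simp
    next
      case False
      then have "{\<omega> \<in> space M. rev_path (\<lambda>i. S i \<omega>) n = l'} \<noteq> {}"
        by (metis measure_empty)
      then obtain \<omega>' where \<omega>': "rev_path (\<lambda>i. S i \<omega>') n = l'" by auto
      \<comment> \<open>The path \<open>l\<close> as a sequence; the values beyond \<open>Suc n\<close> do not matter.\<close>
      define s where "s i = (if i \<le> n then S i \<omega>' else w)" for i
      have prefix: "rev_path (\<lambda>i. S i \<omega>) n = l' \<longleftrightarrow> (\<forall>i\<le>n. S i \<omega> = s i)" for \<omega>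
        unfolding \<omega>'[symmetric] rev_path_eq_iff by (simp add: s_def)
      have "hd l' = s n"
        using \<omega>' hd_rev_path[of "\<lambda>i. S i \<omega>'" n] by (simp add: s_def)
      have "\<P>(\<omega> in M. \<forall>i\<le>n. S i \<omega> = s i) > 0"
        using False unfolding prefix by (simp add: zero_less_measure_iff)
      from S_step[OF this]
      have "\<P>(\<omega> in M. S (Suc n) \<omega> = w \<and> (\<forall>i\<le>n. S i \<omega> = s i))
          = \<P>(\<omega> in M. \<forall>i\<le>n. S i \<omega> = s i) * pmf (pmf_of_set {w. adj (s n) w}) w"
        using False unfolding prefix cond_prob_def by (simp add: s_def field_simps)
      then show ?thesis
        using IH unfolding Cons pmf_Cons_path_pmf \<open>hd l' = s n\<close>
        by (simp add: prefix)
    qed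
  qed
qed

text \<open>
  Since lists over a countable type are countable, the probabilities of single paths determine the
  law. From here on the probability space no longer matters.
\<close>

lemma distr_rev_path:
  fixes S :: "nat \<Rightarrow> 'w \<Rightarrow> 'v :: countable"
  assumes "simple_random_walk M adj v S"
  shows "(\<lambda>\<omega>. rev_path (\<lambda>i. S i \<omega>) n) \<in> M \<rightarrow>\<^sub>M count_space UNIV" (is "?X \<in> _")
    and "distr M (count_space UNIV) (\<lambda>\<omega>. rev_path (\<lambda>i. S i \<omega>) n) = path_pmf adj v n"
proof -
  interpret simple_random_walk M adj v S by fact
  show X: "?X \<in> M \<rightarrow>\<^sub>M count_space UNIV"
  proof (rule measurable_count_space_eq2_countable[THEN iffD2, rule_format], safe)
    fix l show "?X -` {l} \<inter> space M \<in> sets M"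
      using measurable_cylinder[of n l] by (auto simp: vimage_def Int_def conj_commute)
  qed auto
  show "distr M (count_space UNIV) ?X = path_pmf adj v n"
  proof (rule measure_eqI_countable[of _ UNIV])
    fix l :: "'v list"
    have "emeasure (distr M (count_space UNIV) ?X) {l} = \<P>(\<omega> in M. ?X \<omega> = l)"
      using X by (simp add: emeasure_distr emeasure_eq_measure vimage_def Int_def conj_commute)
    then show "emeasure (distr M (count_space UNIV) ?X) {l} = emeasure (path_pmf adj v n) {l}"
      by (simp add: prob_rev_path emeasure_pmf_single)
  qed auto
qed

section \<open>Expectations along the comb walk\<close>

abbreviation comb_mean :: "nat \<Rightarrow> ((int \<times> int) list \<Rightarrow> real) \<Rightarrow> real" where
  "comb_mean n F \<equiv> measure_pmf.expectation (path_pmf comb_adj (0, 0) n) F"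

definition step_mean :: "((int \<times> int) list \<Rightarrow> real) \<Rightarrow> (int \<times> int) list \<Rightarrow> real" where
  "step_mean F l = measure_pmf.expectation (pmf_of_set {w. comb_adj (hd l) w}) (\<lambda>w. F (w # l))"

lemma comb_neighbours_finite: "finite {w. comb_adj v w}" and comb_neighbours_nonempty: "{w. comb_adj v w} \<noteq> {}"
  by (cases v; simp add: comb_neighbours)+

lemma finite_set_pmf_neighbours: "finite (set_pmf (pmf_of_set (Collect (comb_adj v))))"
  using set_pmf_of_set[OF comb_neighbours_nonempty comb_neighbours_finite, of v]
    comb_neighbours_finite[of v] by simp

lemma set_pmf_path_pmf: "finite (set_pmf (path_pmf comb_adj v n))" "[] \<notin> set_pmf (path_pmf comb_adj v n)"
  by (induction n) (auto simp: finite_set_pmf_neighbours)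

lemma integrable_path_pmf [simp]: "integrable (path_pmf comb_adj v n) (F :: _ \<Rightarrow> real)"
  by (intro integrable_measure_pmf_finite set_pmf_path_pmf)

lemma comb_mean_cong:
  assumes "\<And>l. l \<noteq> [] \<Longrightarrow> F l = G l"
  shows "comb_mean n F = comb_mean n G"
proof (rule integral_cong_AE)
  have "F l = G l" if "l \<in> set_pmf (path_pmf comb_adj (0, 0) n)" for l
    using that set_pmf_path_pmf(2) assms by metis
  then show "AE l in path_pmf comb_adj (0, 0) n. F l = G l"
    by (simp add: AE_measure_pmf_iff)
qed auto

lemma comb_mean_mono:
  assumes "\<And>l. F l \<le> G l"
  shows "comb_mean n F \<le> comb_mean n G"
  using assms by (intro integral_mono) auto

lemma comb_mean_Suc: "comb_mean (Suc n) F = comb_mean n (step_mean F)"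
proof -
  let ?p = "path_pmf comb_adj (0, 0) n"
  have "comb_mean (Suc n) F = (\<Sum>l\<in>set_pmf ?p. pmf ?p l *\<^sub>R step_mean F l)"
    unfolding path_pmf.simps step_mean_def
    by (subst pmf_expectation_bind[of "set_pmf ?p"])
      (auto simp: set_pmf_path_pmf finite_set_pmf_neighbours)
  also have "\<dots> = comb_mean n (step_mean F)"
    by (subst integral_measure_pmf[of "set_pmf ?p"]) (auto simp: set_pmf_path_pmf)
  finally show ?thesis .
qed

lemma step_mean_eq:
  assumes "hd l = (x, y)"
  shows "step_mean F l =
    (if y = 0 then (F ((x, 1) # l) + F ((x, -1) # l) + F ((x + 1, 0) # l) + F ((x - 1, 0) # l)) / 4
     else (F ((x, y + 1) # l) + F ((x, y - 1) # l)) / 2)"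
  unfolding step_mean_def
  by (subst integral_pmf_of_set[OF comb_neighbours_nonempty comb_neighbours_finite])
    (auto simp: assms comb_neighbours)

section \<open>The maximum of the comb walk against that of simple random walk\<close>

text \<open>
  With \<open>\<sigma> = 1\<close> these measure the upward excursion, with \<open>\<sigma> = -1\<close> the downward one.
\<close>

definition height :: "int \<Rightarrow> (int \<times> int) list \<Rightarrow> int" where
  "height \<sigma> l = \<sigma> * snd (hd l)"

definition peak :: "int \<Rightarrow> (int \<times> int) list \<Rightarrow> int" where
  "peak \<sigma> l = Max ((\<lambda>v. \<sigma> * snd v) ` set l)"

definition gap :: "int \<Rightarrow> (int \<times> int) list \<Rightarrow> nat" where
  "gap \<sigma> l = nat (peak \<sigma> l - height \<sigma> l)"

text \<open>
  The expected maximum of the whole path after \<open>k\<close> further steps if from now on the vertical coordinate were to move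
  as a simple random walk. It is the potential with which the comb walk is compared.
\<close>

definition predicted_peak :: "int \<Rightarrow> nat \<Rightarrow> (int \<times> int) list \<Rightarrow> real" where
  "predicted_peak \<sigma> k l = of_int (height \<sigma> l) + mean_gap k (gap \<sigma> l)"

lemma peak_Cons: "l \<noteq> [] \<Longrightarrow> peak \<sigma> (w # l) = max (\<sigma> * snd w) (peak \<sigma> l)"
  by (simp add: peak_def)

lemma height_le_peak: "l \<noteq> [] \<Longrightarrow> height \<sigma> l \<le> peak \<sigma> l"
  unfolding height_def peak_def by (rule Max_ge) auto

lemma predicted_peak_Cons:
  assumes "l \<noteq> []" and w: "\<sigma> * snd w = height \<sigma> l + e"
  shows "e = 1 \<Longrightarrow> predicted_peak \<sigma> k (w # l) = height \<sigma> l + 1 + mean_gap k (gap \<sigma> l - 1)"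
    and "e = -1 \<Longrightarrow> predicted_peak \<sigma> k (w # l) = height \<sigma> l - 1 + mean_gap k (gap \<sigma> l + 1)"
    and "e = 0 \<Longrightarrow> predicted_peak \<sigma> k (w # l) = predicted_peak \<sigma> k l"
proof -
  have h: "height \<sigma> (w # l) = height \<sigma> l + e"
    using w by (simp add: height_def)
  have p: "peak \<sigma> (w # l) = max (height \<sigma> l + e) (peak \<sigma> l)"
    using w assms(1) by (simp add: peak_Cons)
  note * = h p height_le_peak[OF assms(1), of \<sigma>]
  have "e = 1 \<Longrightarrow> gap \<sigma> (w # l) = gap \<sigma> l - 1" "e = -1 \<Longrightarrow> gap \<sigma> (w # l) = gap \<sigma> l + 1"
    "e = 0 \<Longrightarrow> gap \<sigma> (w # l) = gap \<sigma> l"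
    using * by (auto simp: gap_def max_def)
  then show "e = 1 \<Longrightarrow> predicted_peak \<sigma> k (w # l) = height \<sigma> l + 1 + mean_gap k (gap \<sigma> l - 1)"
    and "e = -1 \<Longrightarrow> predicted_peak \<sigma> k (w # l) = height \<sigma> l - 1 + mean_gap k (gap \<sigma> l + 1)"
    and "e = 0 \<Longrightarrow> predicted_peak \<sigma> k (w # l) = predicted_peak \<sigma> k l"
    by (simp_all add: predicted_peak_def h)
qed

definition at_axis :: "(int \<times> int) list \<Rightarrow> real" where
  "at_axis l = of_bool (snd (hd l) = 0)"

text \<open>
  Off the axis the comb walk moves vertically like simple random walk, so the prediction is a
  martingale. On the axis half of the mass moves horizontally and wastes a unit of time. This costs
  half of \<open>mean_gap (Suc k) d - mean_gap k d\<close>, and that difference is \<open>record_prob k d / 2\<close>.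
\<close>

lemma step_mean_predicted_peak:
  assumes l: "l \<noteq> []" and \<sigma>: "\<sigma> = 1 \<or> \<sigma> = -1"
  shows "step_mean (predicted_peak \<sigma> k) l
    = predicted_peak \<sigma> (Suc k) l - at_axis l * record_prob k (gap \<sigma> l) / 4"
proof -
  obtain x y where xy: "hd l = (x, y)" by fastforce
  \<comment> \<open>For either sign of \<open>\<sigma>\<close> the two vertical steps are one towards and one away from the peak.\<close>
  have vertical: "predicted_peak \<sigma> k ((x, y + 1) # l) + predicted_peak \<sigma> k ((x, y - 1) # l)
      = 2 * predicted_peak \<sigma> (Suc k) l"
    using predicted_peak_Cons(1)[OF l, of \<sigma> "(x, y + \<sigma>)" 1 k]
      predicted_peak_Cons(2)[OF l, of \<sigma> "(x, y - \<sigma>)" "-1" k] \<sigma>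
    by (auto simp: predicted_peak_def[of \<sigma> "Suc k"] mean_gap_step height_def xy)
  show ?thesis
  proof (cases "y = 0")
    case True
    have horizontal: "predicted_peak \<sigma> k ((x', 0) # l) = predicted_peak \<sigma> (Suc k) l - record_prob k (gap \<sigma> l) / 2" for x'
      using predicted_peak_Cons(3)[OF l, of \<sigma> "(x', 0)" 0 k] True
      by (simp add: predicted_peak_def[of \<sigma> k l] predicted_peak_def[of \<sigma> "Suc k"] mean_gap_Suc height_def xy)
    show ?thesis
      using vertical True
      by (simp add: step_mean_eq[OF xy] horizontal at_axis_def xy field_simps)
  next
    case False
    then show ?thesis
      using vertical by (simp add: step_mean_eq[OF xy] at_axis_def xy)
  qed
qed

text \<open>
  Summing the losses of the single steps gives an exact formula for the expected maximum: that of
  simple random walk minus the time wasted on the axis, each wasted unit weighted by the chance of a record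
  that it would have had at the end.
\<close>

lemma comb_mean_predicted_peak:
  assumes \<sigma>: "\<sigma> = 1 \<or> \<sigma> = -1"
  shows "comb_mean n (predicted_peak \<sigma> k) = mean_gap (n + k) 0
    - (\<Sum>i<n. comb_mean i (\<lambda>l. at_axis l * record_prob (n + k - Suc i) (gap \<sigma> l) / 4))"
proof (induction n arbitrary: k)
  case 0
  show ?case by (simp add: predicted_peak_def height_def gap_def peak_def)
next
  case (Suc n)
  have "comb_mean (Suc n) (predicted_peak \<sigma> k)
      = comb_mean n (\<lambda>l. predicted_peak \<sigma> (Suc k) l - at_axis l * record_prob k (gap \<sigma> l) / 4)"
    unfolding comb_mean_Suc by (intro comb_mean_cong step_mean_predicted_peak \<sigma>)
  also have "\<dots> = comb_mean n (predicted_peak \<sigma> (Suc k)) - comb_mean n (\<lambda>l. at_axis l * record_prob k (gap \<sigma> l) / 4)"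
    by (rule Bochner_Integration.integral_diff) auto
  finally show ?case by (simp add: Suc.IH)
qed

lemma comb_mean_peak:
  assumes \<sigma>: "\<sigma> = 1 \<or> \<sigma> = -1"
  shows "comb_mean n (\<lambda>l. of_int (peak \<sigma> l)) = mean_gap n 0
    - (\<Sum>i<n. comb_mean i (\<lambda>l. at_axis l * record_prob (n - Suc i) (gap \<sigma> l) / 4))"
proof -
  have "comb_mean n (\<lambda>l. of_int (peak \<sigma> l)) = comb_mean n (predicted_peak \<sigma> 0)"
    using height_le_peak by (intro comb_mean_cong) (simp add: predicted_peak_def gap_def mean_gap_def)
  then show ?thesis using comb_mean_predicted_peak[OF \<sigma>, of n 0] by simp
qed

section \<open>The time spent on the axis\<close>

text \<open>
  Tanaka's formula in discrete form: the absolute value of the vertical coordinate has drift only on the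
  axis, and there its drift is \<open>1/2\<close>, the probability of a vertical step.
\<close>

lemma comb_mean_abs: "comb_mean n (\<lambda>l. \<bar>of_int (snd (hd l))\<bar>) = (\<Sum>i<n. comb_mean i at_axis) / 2"
proof (induction n)
  case (Suc n)
  have "step_mean (\<lambda>l. \<bar>of_int (snd (hd l))\<bar>) l = \<bar>of_int (snd (hd l))\<bar> + at_axis l / 2" for l
    by (cases "hd l") (auto simp: step_mean_eq at_axis_def)
  then have "step_mean (\<lambda>l. \<bar>of_int (snd (hd l))\<bar>) = (\<lambda>l. \<bar>of_int (snd (hd l))\<bar> + at_axis l / 2)"
    by (rule ext)
  then show ?case
    unfolding comb_mean_Suc by (simp add: Suc add_divide_distrib)
qed auto

lemma comb_mean_square: "comb_mean n (\<lambda>l. (of_int (snd (hd l)))\<^sup>2) \<le> n"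
proof (induction n)
  case (Suc n)
  have "step_mean (\<lambda>l. (of_int (snd (hd l)))\<^sup>2) l \<le> (of_int (snd (hd l)))\<^sup>2 + 1" for l
    by (cases "hd l") (auto simp: step_mean_eq power2_eq_square algebra_simps)
  then have "comb_mean (Suc n) (\<lambda>l. (of_int (snd (hd l)))\<^sup>2) \<le> comb_mean n (\<lambda>l. (of_int (snd (hd l)))\<^sup>2 + 1)"
    unfolding comb_mean_Suc by (rule comb_mean_mono)
  then show ?case using Suc by simp
qed auto

text \<open>
  The number of visits to the axis is twice the mean absolute height, which the second moment controls.
\<close>

lemma axis_visits_bound: "(\<Sum>i<n. comb_mean i at_axis) \<le> 2 * sqrt n"
proof (cases "n = 0")
  case False
  \<comment> \<open>With this weight in the inequality of the means, \<open>y\<^sup>2 = n\<close> balances both terms at \<open>sqrt n / 2\<close>.\<close>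
  have "\<bar>y\<bar> \<le> y\<^sup>2 / (2 * sqrt n) + sqrt n / 2" for y :: real
  proof -
    have "0 \<le> (\<bar>y\<bar> - sqrt n)\<^sup>2" by simp
    then have "2 * sqrt n * \<bar>y\<bar> \<le> y\<^sup>2 + n" by (simp add: power2_diff mult_ac)
    then show ?thesis using False by (simp add: field_simps)
  qed
  then have "comb_mean n (\<lambda>l. \<bar>of_int (snd (hd l))\<bar>)
      \<le> comb_mean n (\<lambda>l. (of_int (snd (hd l)))\<^sup>2 / (2 * sqrt n) + sqrt n / 2)"
    by (intro comb_mean_mono)
  also have "\<dots> = comb_mean n (\<lambda>l. (of_int (snd (hd l)))\<^sup>2) / (2 * sqrt n) + sqrt n / 2"
    by simp
  also have "\<dots> \<le> n / (2 * sqrt n) + sqrt n / 2"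
    by (intro add_right_mono divide_right_mono comb_mean_square) auto
  also have "\<dots> = sqrt n" using False by (simp add: field_simps)
  finally show ?thesis by (simp add: comb_mean_abs)
qed simp

section \<open>Asymptotics\<close>

text \<open>
  All but boundedly many of the weights \<open>w (n - Suc i)\<close> are small. The small ones contribute a small multiple
  of \<open>sqrt n\<close> because \<open>z\<close> has total mass of that order, and the others contribute a bounded amount.
\<close>

lemma convolution_negligible:
  fixes z w :: "nat \<Rightarrow> real"
  assumes z: "\<And>i. 0 \<le> z i" "\<And>i. z i \<le> 1" "\<And>n. (\<Sum>i<n. z i) \<le> C * sqrt n"
    and w: "\<And>k. 0 \<le> w k" "\<And>k. w k \<le> 1" "w \<longlonglongrightarrow> 0"
  shows "(\<lambda>n. (\<Sum>i<n. z i * w (n - Suc i)) / sqrt n) \<longlonglongrightarrow> 0"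
proof (rule LIMSEQ_I)
  fix e :: real assume e: "e > 0"
  have C: "C \<ge> 0" using z(3)[of 1] z(1)[of 0] by simp
  \<comment> \<open>\<open>C + 1\<close> instead of \<open>C\<close> avoids division by \<open>0\<close>.\<close>
  define d where "d = e / (2 * (C + 1))"
  have d: "d > 0" "d * C \<le> e / 2" using e C by (auto simp: d_def field_simps)
  obtain K where K: "\<And>k. k \<ge> K \<Longrightarrow> w k < d"
    using order_tendstoD(2)[OF w(3) d(1)] by (auto simp: eventually_sequentially)
  have bound: "(\<Sum>i<n. z i * w (n - Suc i)) \<le> e / 2 * sqrt n + K" for n
  proof -
    have "(\<Sum>i<n. z i * w (n - Suc i)) \<le> (\<Sum>i<n. d * z i + of_bool (n - Suc i < K))"
    proof (rule sum_mono)
      fix i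
      have "z i * w (n - Suc i) \<le> 1 * 1" by (intro mult_mono z w) auto
      moreover have "z i * w (n - Suc i) \<le> z i * d" if "K \<le> n - Suc i"
        using K[OF that] z(1) by (intro mult_left_mono) auto
      ultimately show "z i * w (n - Suc i) \<le> d * z i + of_bool (n - Suc i < K)"
        using z(1)[of i] d(1) by (cases "K \<le> n - Suc i") (auto simp: mult.commute intro: add_increasing)
    qed
    also have "\<dots> = d * (\<Sum>i<n. z i) + (\<Sum>i<n. of_bool (n - Suc i < K))"
      by (simp add: sum.distrib sum_distrib_left)
    also have "(\<Sum>i<n. of_bool (n - Suc i < K) :: real) = (\<Sum>i<n. of_bool (i < K))"
      by (rule sum.nat_diff_reindex)
    also have "\<dots> = card ({..<n} \<inter> {..<K})"
      by (simp add: of_bool_def sum.If_cases lessThan_def Collect_conj_eq)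
    also have "\<dots> \<le> card {..<K}" by (intro of_nat_mono card_mono) auto
    also have "d * (\<Sum>i<n. z i) \<le> d * (C * sqrt n)"
      using d z(3) by (intro mult_left_mono) auto
    also have "\<dots> \<le> e / 2 * sqrt n"
      using mult_right_mono[OF d(2), of "sqrt n"] by (simp add: mult.assoc)
    finally show ?thesis by simp
  qed
  have "filterlim (\<lambda>n. sqrt (real n)) at_top sequentially"
    by (intro filterlim_compose[OF sqrt_at_top] filterlim_real_sequentially)
  then have "\<forall>\<^sub>F n in sequentially. 2 * K / e < sqrt n"
    by (simp add: filterlim_at_top_dense)
  then obtain N where N: "2 * K / e < sqrt n" if "n \<ge> N" for n :: nat
    unfolding eventually_sequentially by blast
  show "\<exists>N. \<forall>n\<ge>N. norm ((\<Sum>i<n. z i * w (n - Suc i)) / sqrt n - 0) < e"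
  proof (intro exI allI impI)
    fix n assume n: "n \<ge> N"
    have pos: "sqrt n > 0" using N[OF n] e by (smt (verit) divide_nonneg_pos of_nat_0_le_iff)
    have "(\<Sum>i<n. z i * w (n - Suc i)) < e * sqrt n"
      using bound[of n] N[OF n] e by (simp add: field_simps)
    moreover have "0 \<le> (\<Sum>i<n. z i * w (n - Suc i))"
      by (intro sum_nonneg mult_nonneg_nonneg z w)
    ultimately show "norm ((\<Sum>i<n. z i * w (n - Suc i)) / sqrt n - 0) < e"
      using pos by (simp add: field_simps)
  qed
qed

lemma comb_mean_peak_limit:
  assumes \<sigma>: "\<sigma> = 1 \<or> \<sigma> = -1"
  shows "(\<lambda>n. comb_mean n (\<lambda>l. of_int (peak \<sigma> l)) / sqrt n) \<longlonglongrightarrow> sqrt (2 / pi)"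
proof -
  define loss where
    "loss n = (\<Sum>i<n. comb_mean i (\<lambda>l. at_axis l * record_prob (n - Suc i) (gap \<sigma> l) / 4))" for n
  have loss_nonneg: "0 \<le> loss n" for n
    unfolding loss_def
    by (intro sum_nonneg Bochner_Integration.integral_nonneg) (auto simp: at_axis_def record_prob_nonneg)
  have loss_le: "loss n \<le> (\<Sum>i<n. comb_mean i at_axis * record_prob (n - Suc i) 0)" for n
    unfolding loss_def
  proof (rule sum_mono)
    fix i
    have "comb_mean i (\<lambda>l. at_axis l * record_prob (n - Suc i) (gap \<sigma> l) / 4)
        \<le> comb_mean i (\<lambda>l. at_axis l * record_prob (n - Suc i) 0)"
    proof (rule comb_mean_mono)
      fix l
      show "at_axis l * record_prob (n - Suc i) (gap \<sigma> l) / 4 \<le> at_axis l * record_prob (n - Suc i) 0"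
        using record_prob_le_gap_0[of "n - Suc i" "gap \<sigma> l"] record_prob_nonneg[of "n - Suc i" "gap \<sigma> l"]
        by (simp add: at_axis_def)
    qed
    then show "comb_mean i (\<lambda>l. at_axis l * record_prob (n - Suc i) (gap \<sigma> l) / 4)
        \<le> comb_mean i at_axis * record_prob (n - Suc i) 0" by simp
  qed
  have at_axis_mean: "0 \<le> comb_mean i at_axis" "comb_mean i at_axis \<le> 1" for i
  proof -
    show "0 \<le> comb_mean i at_axis" by (intro Bochner_Integration.integral_nonneg) (auto simp: at_axis_def)
    have "comb_mean i at_axis \<le> comb_mean i (\<lambda>_. 1)" by (intro comb_mean_mono) (auto simp: at_axis_def)
    then show "comb_mean i at_axis \<le> 1" by simp
  qed
  have "(\<lambda>n. loss n / sqrt n) \<longlonglongrightarrow> 0"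
  proof (rule tendsto_sandwich[OF _ _ tendsto_const])
    show "(\<lambda>n. (\<Sum>i<n. comb_mean i at_axis * record_prob (n - Suc i) 0) / sqrt n) \<longlonglongrightarrow> 0"
      by (intro convolution_negligible[where C = 2] at_axis_mean axis_visits_bound
          record_prob_nonneg record_prob_le_1 record_prob_tendsto_0)
    show "\<forall>\<^sub>F n in sequentially. loss n / sqrt n
        \<le> (\<Sum>i<n. comb_mean i at_axis * record_prob (n - Suc i) 0) / sqrt n"
      using loss_le by (intro always_eventually allI divide_right_mono) auto
  qed (use loss_nonneg in auto)
  from tendsto_diff[OF mean_gap_limit this] show ?thesis
    by (simp add: comb_mean_peak[OF \<sigma>] loss_def diff_divide_distrib)
qed

text \<open>
  The two indices in the span vary independently, so it is the highest height plus the
  greatest depth.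
\<close>

lemma span_y_eq:
  "span_y S n \<omega> = peak 1 (rev_path (\<lambda>i. S i \<omega>) n) + peak (-1) (rev_path (\<lambda>i. S i \<omega>) n)"
proof -
  define y where "y i = snd (S i \<omega>)" for i
  have peaks: "peak \<sigma> (rev_path (\<lambda>i. S i \<omega>) n) = Max ((\<lambda>i. \<sigma> * y i) ` {..n})" for \<sigma>
    unfolding peak_def set_rev_path image_image y_def ..
  have "{y i - y j |i j. i \<le> n \<and> j \<le> n} = (\<lambda>(i, j). y i - y j) ` ({..n} \<times> {..n})"
    by auto
  then have fin: "finite {y i - y j |i j. i \<le> n \<and> j \<le> n}"
    by simp
  let ?up = "(\<lambda>i. 1 * y i) ` {..n}" and ?down = "(\<lambda>i. - 1 * y i) ` {..n}"
  have "Max ?up \<in> ?up" "Max ?down \<in> ?down"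
    by (intro Max_in; simp)+
  then obtain i j where i: "i \<le> n" "Max ?up = 1 * y i" and j: "j \<le> n" "Max ?down = - 1 * y j"
    by (elim imageE) auto
  have "y i' \<le> y i" "y j \<le> y i'" if "i' \<le> n" for i'
  proof -
    have "1 * y i' \<le> Max ?up" "- 1 * y i' \<le> Max ?down"
      using that by (intro Max_ge; auto)+
    then show "y i' \<le> y i" "y j \<le> y i'" unfolding i j by auto
  qed
  then have "Max {y i - y j |i j. i \<le> n \<and> j \<le> n} = y i - y j"
    using i(1) j(1) by (intro Max_eqI[OF fin]) (auto intro: diff_mono)
  then show ?thesis
    using i j by (simp add: span_y_def peaks y_def)
qed

theorem theorem5p2:
  fixes M :: "'w measure" and S :: "nat \<Rightarrow> 'w \<Rightarrow> int \<times> int"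
  assumes "simple_random_walk M comb_adj (0, 0) S"
  shows "(\<lambda>n. \<integral>\<omega>. real_of_int (span_y S n \<omega>) \<partial>M)
    \<sim>[sequentially] (\<lambda>n. sqrt (8 / pi) * real n powr (1 / 2))"
proof -
  have mean: "(\<integral>\<omega>. real_of_int (span_y S n \<omega>) \<partial>M)
      = comb_mean n (\<lambda>l. of_int (peak 1 l)) + comb_mean n (\<lambda>l. of_int (peak (-1) l))" for n
  proof -
    let ?X = "\<lambda>\<omega>. rev_path (\<lambda>i. S i \<omega>) n"
    have "(\<integral>\<omega>. real_of_int (span_y S n \<omega>) \<partial>M)
        = (\<integral>l. of_int (peak 1 l + peak (-1) l) \<partial>distr M (count_space UNIV) ?X)"
      by (subst integral_distr[OF distr_rev_path(1)[OF assms]]) (simp_all add: span_y_eq)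
    also have "\<dots> = comb_mean n (\<lambda>l. of_int (peak 1 l + peak (-1) l))"
      unfolding distr_rev_path(2)[OF assms] ..
    finally show ?thesis by simp
  qed
  have "(\<lambda>n. (\<integral>\<omega>. real_of_int (span_y S n \<omega>) \<partial>M) / sqrt n) \<longlonglongrightarrow> sqrt (2 / pi) + sqrt (2 / pi)"
    unfolding mean add_divide_distrib by (intro tendsto_add comb_mean_peak_limit) auto
  moreover have "sqrt (2 / pi) + sqrt (2 / pi) = sqrt (8 / pi)"
    using real_sqrt_mult[of 4 "2 / pi"] by simp
  ultimately have "(\<lambda>n. (\<integral>\<omega>. real_of_int (span_y S n \<omega>) \<partial>M) / sqrt n / sqrt (8 / pi)) \<longlonglongrightarrow> sqrt (8 / pi) / sqrt (8 / pi)"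
    by (intro tendsto_divide tendsto_const) auto
  then show ?thesis
    by (intro asymp_equivI') (simp add: powr_half_sqrt mult.commute)
qed

end
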